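(* Let $H\in\mathbb{F}_q[x]$ and let $D_1,D_2$ be monic divisors of $H$. Then $$\phi(D_2)\,\eta\!\left(\frac{H}{D_2},D_1\right)=\phi(D_1)\,\eta\!\left(\frac{H}{D_1},D_2\right).$$
   Context: Let $\mathbb{F}_q$ be a finite field with $q$ elements and fix a non-trivial homomorphism $\lambda:(\mathbb{F}_q,+)\to\mathbb{C}^*$. For nonzero $M\in\mathbb{F}_q[x]$ of degree $m\ge1$ and $A\in\mathbb{F}_q[x]$, let $t_M(A)$ be the coefficient of $x^{m-1}$ in the remainder of $A$ on division by $M$ (if $m=0$, $t_M(A)=0$), and $E(G,M)(A)=\lambda(t_M(GA))$. For nonzero $D$, $\eta(G,D)=\sum_{R}E(G,D)(R)$, where $R$ runs over a complete residue system modulo $D$ with $\gcd(R,D)=1$. $|A|=q^{\deg A}$, and $\phi(D)=|D|\prod_{P}(1-|P|^{-1})$, the product over monic irreducible $P$ dividing $D$ (the number of polynomials of degree $<\deg D$ coprime to $D$). *)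

theory Defs
  imports Complex_Main "HOL-Library.Cardinality" "HOL-Computational_Algebra.Polynomial"
begin

definition nontrivial_add_char :: "('a::{finite,field} \<Rightarrow> complex) \<Rightarrow> bool" where
  "nontrivial_add_char \<psi> \<longleftrightarrow>
     (\<forall>a. \<psi> a \<noteq> 0) \<and> (\<forall>a b. \<psi> (a + b) = \<psi> a * \<psi> b) \<and> (\<exists>a. \<psi> a \<noteq> 1)"

definition tcoeff :: "'a::{finite,field} poly \<Rightarrow> 'a poly \<Rightarrow> 'a" where
  "tcoeff M A = (if degree M = 0 then 0 else coeff (A mod M) (degree M - 1))"

definition echar ::
    "('a::{finite,field} \<Rightarrow> complex) \<Rightarrow> 'a poly \<Rightarrow> 'a poly \<Rightarrow> 'a poly \<Rightarrow> complex" where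
  "echar \<psi> G M A = \<psi> (tcoeff M (G * A))"

text \<open>
  The sum runs over the standard complete residue system, consisting of the remainders modulo \<open>D\<close>.
  Lemma \<open>eta_complete_residue_system\<close> shows that every other complete residue system gives
  the same value.
\<close>

definition eta ::
    "('a::{finite,field} \<Rightarrow> complex) \<Rightarrow> 'a poly \<Rightarrow> 'a poly \<Rightarrow> complex" where
  "eta \<psi> G D = (\<Sum>R | R mod D = R \<and> coprime R D. echar \<psi> G D R)"

definition pnorm :: "'a::{finite,field} poly \<Rightarrow> real" where
  "pnorm A = (if A = 0 then 0 else real CARD('a) ^ degree A)"

definition pphi :: "'a::{finite,field} poly \<Rightarrow> real" where
  "pphi D = pnorm D *
     (\<Prod>P | lead_coeff P = 1 \<and> irreducible P \<and> P dvd D. 1 - inverse (pnorm P))"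

definition complete_residue_system :: "'a::{finite,field} poly \<Rightarrow> 'a poly set \<Rightarrow> bool" where
  "complete_residue_system D S \<longleftrightarrow> (\<forall>A. \<exists>!R. R \<in> S \<and> R mod D = A mod D)"

lemma eta_complete_residue_system:
  assumes "D \<noteq> 0" and "complete_residue_system D S"
  shows "eta \<psi> G D = (\<Sum>R | R \<in> S \<and> coprime R D. echar \<psi> G D R)"
proof -
  have inj: "inj_on (\<lambda>R. R mod D) {R. R \<in> S \<and> coprime R D}"
    using assms(2) unfolding complete_residue_system_def inj_on_def by blast
  have img: "(\<lambda>R. R mod D) ` {R. R \<in> S \<and> coprime R D} = {R. R mod D = R \<and> coprime R D}"
  proof (intro equalityI subsetI)
    fix A assume A: "A \<in> {R. R mod D = R \<and> coprime R D}"
    obtain R where R: "R \<in> S" "R mod D = A mod D"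
      using assms(2) unfolding complete_residue_system_def by blast
    with A assms(1) have "coprime R D"
      by (metis (mono_tags, lifting) coprime_mod_left_iff mem_Collect_eq)
    with A R show "A \<in> (\<lambda>R. R mod D) ` {R. R \<in> S \<and> coprime R D}"
      by (auto intro!: image_eqI[of _ _ R])
  qed (use assms(1) in auto)
  have eq: "echar \<psi> G D (R mod D) = echar \<psi> G D R" for R
    by (simp add: echar_def tcoeff_def mod_mult_right_eq)
  show ?thesis
    unfolding eta_def img[symmetric] sum.reindex[OF inj] by (simp add: eq)
qed

end

theory Submission
  imports Defs "HOL-Computational_Algebra.Polynomial_Factorial"
begin

text \<open>
  For monic \<open>M\<close> and \<open>K\<close> we have \<open>t\<^bsub>MK\<^esub>(KA) = t\<^bsub>M\<^esub>(A)\<close>. Hence both \<open>\<eta>(H/D\<^sub>2, D\<^sub>1)\<close> and \<open>\<eta>(H/D\<^sub>1, D\<^sub>2)\<close> are sums of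
  the same function \<open>f(R) = \<lambda>(t\<^bsub>N\<^esub>(HR))\<close> with \<open>N = D\<^sub>1D\<^sub>2\<close>, over the reduced residues modulo \<open>D\<^sub>1\<close> and
  modulo \<open>D\<^sub>2\<close> respectively, and \<open>f\<close> is periodic with respect to both moduli. The sum of a
  \<open>D\<close>-periodic function over the reduced residues modulo a multiple \<open>KD\<close> is \<open>\<phi>(KD)/\<phi>(D)\<close> times
  its sum over the reduced residues modulo \<open>D\<close>: this is checked by adjoining the irreducible
  factors of \<open>K\<close> one at a time. Comparing both sums with the one modulo \<open>N\<close> proves the theorem.
\<close>

section \<open>Residues and divisors: finiteness and counting\<close>

text \<open>Vanishing of coefficients, rather than a bound on the degree, treats
  \<open>R = 0\<close> and constant \<open>D\<close> uniformly and suits an induction that strips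
  off the constant term.\<close>

lemma mod_poly_eq_self_iff:
  fixes D R :: "'a::field poly"
  assumes "D \<noteq> 0"
  shows "R mod D = R \<longleftrightarrow> (\<forall>i\<ge>degree D. coeff R i = 0)"
proof
  assume *: "R mod D = R"
  show "\<forall>i\<ge>degree D. coeff R i = 0"
    using degree_mod_less[OF assms, of R] * by (auto intro: coeff_eq_0)
next
  assume *: "\<forall>i\<ge>degree D. coeff R i = 0"
  show "R mod D = R"
  proof (cases "R = 0")
    case False
    then have "degree R < degree D"
      using * by (metis leading_coeff_0_iff not_less)
    then show ?thesis by (rule mod_poly_less)
  qed simp
qed

lemma polys_coeff_bounded_Suc:
  "{p. \<forall>i\<ge>Suc n. coeff p i = 0} = (\<lambda>(a, p). pCons a p) ` (UNIV \<times> {p. \<forall>i\<ge>n. coeff p i = 0})"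
proof (intro equalityI subsetI)
  fix p :: "'a poly" assume "p \<in> {p. \<forall>i\<ge>Suc n. coeff p i = 0}"
  moreover obtain a r where "p = pCons a r" by (cases p)
  ultimately show "p \<in> (\<lambda>(a, p). pCons a p) ` (UNIV \<times> {p. \<forall>i\<ge>n. coeff p i = 0})"
    by (fastforce simp: image_iff)
qed (auto simp: coeff_pCons split: nat.splits)

lemma finite_card_polys_coeff_bounded:
  "finite {p :: 'a::{finite,zero} poly. \<forall>i\<ge>n. coeff p i = 0} \<and>
   card {p :: 'a poly. \<forall>i\<ge>n. coeff p i = 0} = CARD('a) ^ n"
proof (induction n)
  case 0
  have "{p :: 'a poly. \<forall>i\<ge>0. coeff p i = 0} = {0}"
    by (auto simp: poly_eq_iff)
  then show ?case by simp
next
  case (Suc n)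
  have "inj_on (\<lambda>(a, p). pCons a p) (UNIV \<times> {p :: 'a poly. \<forall>i\<ge>n. coeff p i = 0})"
    by (auto simp: inj_on_def)
  then show ?case
    using Suc by (simp add: polys_coeff_bounded_Suc card_image card_cartesian_product)
qed

lemma finite_residues:
  fixes D :: "'a::{finite,field} poly"
  assumes "D \<noteq> 0"
  shows "finite {R. R mod D = R}"
  using finite_card_polys_coeff_bounded[where 'a = 'a, of "degree D"]
  by (simp add: mod_poly_eq_self_iff[OF assms])

lemma card_residues:
  fixes D :: "'a::{finite,field} poly"
  assumes "D \<noteq> 0"
  shows "card {R. R mod D = R} = CARD('a) ^ degree D"
  using finite_card_polys_coeff_bounded[where 'a = 'a, of "degree D"]
  by (simp add: mod_poly_eq_self_iff[OF assms])

lemma finite_poly_divisors: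
  fixes D :: "'a::{finite,field} poly"
  assumes "D \<noteq> 0"
  shows "finite {P. P dvd D}"
proof (rule finite_subset)
  show "{P. P dvd D} \<subseteq> {p. \<forall>i\<ge>Suc (degree D). coeff p i = 0}"
  proof safe
    fix P i assume "P dvd D" "Suc (degree D) \<le> i"
    then have "degree P < i"
      using dvd_imp_degree_le[OF _ assms] by (meson Suc_le_lessD le_less_trans)
    then show "coeff P i = 0" by (rule coeff_eq_0)
  qed
qed (use finite_card_polys_coeff_bounded in blast)

section \<open>Irreducible factors over a field\<close>

lemma irreducible_imp_degree_pos:
  fixes P :: "'a::field poly"
  assumes "irreducible P"
  shows "degree P > 0"
proof (rule ccontr)
  assume "\<not> degree P > 0"
  then have "is_unit P"
    using assms by (metis is_unit_iff_degree not_gr_zero not_irreducible_zero)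
  then show False using assms by (simp add: irreducible_not_unit)
qed

lemma monic_irreducible_divisor_exists:
  fixes A :: "'a::field poly"
  assumes "degree A > 0"
  shows "\<exists>P. lead_coeff P = 1 \<and> irreducible P \<and> P dvd A"
  using assms
proof (induction "degree A" arbitrary: A rule: less_induct)
  case less
  then have "A \<noteq> 0" by auto
  show ?case
  proof (cases "irreducible A")
    case True
    define P where "P = smult (inverse (lead_coeff A)) A"
    have "A = [:lead_coeff A:] * P" "is_unit [:lead_coeff A:]"
      using \<open>A \<noteq> 0\<close> by (auto simp: P_def is_unit_iff_degree)
    then have "irreducible P" "P dvd A"
      using True irreducible_mult_unit_left by (metis, metis dvd_triv_right)
    moreover have "lead_coeff P = 1"
      using \<open>A \<noteq> 0\<close> by (simp add: P_def)
    ultimately show ?thesis by blast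
  next
    case False
    then obtain B C where BC: "A = B * C" "\<not> is_unit B" "\<not> is_unit C"
      using \<open>A \<noteq> 0\<close> less.prems unfolding irreducible_def
      by (metis is_unit_iff_degree not_gr_zero)
    then have "B \<noteq> 0" "C \<noteq> 0" using \<open>A \<noteq> 0\<close> by auto
    then have "degree B > 0" "degree B < degree A"
      using BC by (auto simp: is_unit_iff_degree degree_mult_eq)
    then show ?thesis
      using less.hyps BC(1) by (meson dvd_mult2)
  qed
qed

text \<open>Splitting a monic irreducible factor off a monic polynomial leaves a monic cofactor of
  smaller degree. Units other than 1 therefore never arise, and 1 is the only base case.\<close>

lemma monic_poly_induct [consumes 1, case_names one mult]:
  fixes K :: "'a::field poly"
  assumes "lead_coeff K = 1"
    and one: "Q 1"
    and mult: "\<And>P K. lead_coeff P = 1 \<Longrightarrow> irreducible P \<Longrightarrow> lead_coeff K = 1 \<Longrightarrow> Q K \<Longrightarrow> Q (P * K)"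
  shows "Q K"
  using assms(1)
proof (induction "degree K" arbitrary: K rule: less_induct)
  case less
  show ?case
  proof (cases "degree K = 0")
    case True
    then have "K = 1"
      using less.prems by (metis degree_eq_zeroE lead_coeff_pCons(2) pCons_one)
    then show ?thesis using one by simp
  next
    case False
    then obtain P L where P: "lead_coeff P = 1" "irreducible P" and K: "K = P * L"
      using monic_irreducible_divisor_exists[of K] unfolding dvd_def by blast
    then have L: "lead_coeff L = 1" using less.prems by (simp add: lead_coeff_mult)
    have "P \<noteq> 0" "L \<noteq> 0" using P L by auto
    then have "degree L < degree K"
      using irreducible_imp_degree_pos[OF P(2)] by (simp add: K degree_mult_eq)
    then show ?thesis using mult[OF P L less.hyps] L by (simp add: K)
  qed
qed

lemma irreducible_dvd_mult_iff:
  fixes P A B :: "'a::field poly"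
  assumes "irreducible P"
  shows "P dvd A * B \<longleftrightarrow> P dvd A \<or> P dvd B"
  using field_poly_irreducible_imp_prime[OF assms] by (rule prime_elem_dvd_mult_iff)

lemma coprime_poly_iff_no_irreducible_divisor:
  fixes A B :: "'a::field poly"
  assumes "B \<noteq> 0"
  shows "coprime A B \<longleftrightarrow> (\<forall>P. irreducible P \<longrightarrow> P dvd A \<longrightarrow> \<not> P dvd B)"
proof
  assume "coprime A B"
  then show "\<forall>P. irreducible P \<longrightarrow> P dvd A \<longrightarrow> \<not> P dvd B"
    using coprime_common_divisor irreducible_not_unit by blast
next
  assume *: "\<forall>P. irreducible P \<longrightarrow> P dvd A \<longrightarrow> \<not> P dvd B"
  show "coprime A B"
  proof (rule coprimeI, rule ccontr)
    fix C assume C: "C dvd A" "C dvd B" "\<not> is_unit C"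
    then have "C \<noteq> 0" using assms by auto
    then have "degree C > 0" using C(3) by (simp add: is_unit_iff_degree)
    then obtain P where "irreducible P" "P dvd C"
      using monic_irreducible_divisor_exists by blast
    then show False using * C by (meson dvd_trans)
  qed
qed

text \<open>The cofactor of \<open>P\<close> in \<open>Q\<close> is a unit and monic, hence 1. This
  ensures that passing from \<open>D\<close> to \<open>P * D\<close> adds at most one factor to the
  product in \<open>pphi\<close>.\<close>

lemma associated_monic_irreducible_eq:
  fixes P Q :: "'a::field poly"
  assumes "lead_coeff P = 1" "lead_coeff Q = 1" "irreducible P" "irreducible Q" "P dvd Q"
  shows "P = Q"
proof -
  obtain C where C: "Q = P * C" using assms(5) by (elim dvdE)
  then have "is_unit C"
    using irreducibleD[OF assms(4)] irreducible_not_unit[OF assms(3)] by blast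
  moreover have "lead_coeff C = 1" using assms(1,2) C by (simp add: lead_coeff_mult)
  ultimately have "C = 1"
    by (metis degree_eq_zeroE is_unit_iff_degree lead_coeff_pCons(2) not_is_unit_0 pCons_one)
  then show ?thesis using C by simp
qed

text \<open>An irreducible \<open>Q\<close> dividing \<open>P\<close> is associated to
  \<open>P\<close>, so the only condition added to coprimality with \<open>D\<close> concerns
  \<open>P\<close> itself.\<close>

lemma coprime_irreducible_mult_iff:
  fixes R P D :: "'a::field poly"
  assumes "irreducible P" "D \<noteq> 0"
  shows "coprime R (P * D) \<longleftrightarrow> coprime R D \<and> \<not> P dvd R"
proof -
  have *: "P \<noteq> 0" using assms(1) by auto
  have dvd: "P dvd R" if "irreducible Q" "Q dvd R" "Q dvd P" for Q
  proof -
    obtain C where C: "P = Q * C" using \<open>Q dvd P\<close> by (elim dvdE)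
    then have "is_unit C"
      using irreducibleD[OF assms(1)] irreducible_not_unit[OF \<open>irreducible Q\<close>] by blast
    then show ?thesis using C \<open>Q dvd R\<close> by (simp add: mult_unit_dvd_iff)
  qed
  have "coprime R (P * D) \<longleftrightarrow> (\<forall>Q. irreducible Q \<longrightarrow> Q dvd R \<longrightarrow> \<not> (Q dvd P \<or> Q dvd D))"
    using assms * by (subst coprime_poly_iff_no_irreducible_divisor) (simp_all add: irreducible_dvd_mult_iff)
  also have "\<dots> \<longleftrightarrow> (\<forall>Q. irreducible Q \<longrightarrow> Q dvd R \<longrightarrow> \<not> Q dvd D) \<and> \<not> P dvd R"
    using dvd assms(1) dvd_refl by blast
  finally show ?thesis using assms(2) by (simp add: coprime_poly_iff_no_irreducible_divisor)
qed

section \<open>Lifting reduced residues to a larger modulus\<close>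

text \<open>Counts the lifts of a reduced residue \<open>S\<close> modulo \<open>D\<close> that stay
  reduced modulo \<open>P * D\<close>. If \<open>P\<close> divides \<open>D\<close>, it cannot
  divide \<open>S\<close>, and every lift survives. Otherwise \<open>S + D * T\<close> permutes the
  residues modulo \<open>P\<close>, and exactly one \<open>T\<close> is lost.\<close>

lemma card_residues_not_dvd:
  fixes P D S :: "'a::{finite,field} poly"
  assumes "irreducible P" "coprime S D" "D \<noteq> 0"
  shows "card {T. T mod P = T \<and> \<not> P dvd S + D * T} = CARD('a) ^ degree P - (if P dvd D then 0 else 1)"
proof -
  have "P \<noteq> 0" using assms(1) by auto
  let ?X = "{T. T mod P = T}"
  note fin = finite_residues[OF \<open>P \<noteq> 0\<close>] and card = card_residues[OF \<open>P \<noteq> 0\<close>]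
  show ?thesis
  proof (cases "P dvd D")
    case True
    then have "\<not> P dvd S"
      using assms by (auto simp: coprime_poly_iff_no_irreducible_divisor)
    then have "{T. T mod P = T \<and> \<not> P dvd S + D * T} = ?X"
      using True by (auto simp: dvd_add_left_iff)
    then show ?thesis using card True by simp
  next
    case False
    let ?g = "\<lambda>T. (S + D * T) mod P"
    have inj: "inj_on ?g ?X"
    proof (rule inj_onI)
      fix T U assume "T \<in> ?X" "U \<in> ?X" "?g T = ?g U"
      then have "P dvd D * (T - U)"
        by (simp add: mod_eq_dvd_iff algebra_simps)
      then have "T mod P = U mod P"
        using False assms(1) by (simp add: irreducible_dvd_mult_iff mod_eq_dvd_iff)
      then show "T = U" using \<open>T \<in> ?X\<close> \<open>U \<in> ?X\<close> by simp
    qed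
    have "?g ` ?X = ?X"
      by (rule endo_inj_surj[OF fin _ inj]) auto
    moreover have "0 \<in> ?X" by simp
    ultimately obtain T where T: "T \<in> ?X" "?g T = 0" by (metis (no_types, lifting) imageE)
    have "P dvd S + D * U \<longleftrightarrow> U = T" if "U \<in> ?X" for U
      using inj_on_eq_iff[OF inj that T(1)] unfolding T(2) mod_eq_0_iff_dvd .
    then have "{T. T mod P = T \<and> \<not> P dvd S + D * T} = ?X - {T}"
      by blast
    then show ?thesis using card fin T(1) False by simp
  qed
qed

text \<open>Division by \<open>D\<close> turns the reduced residues modulo \<open>P * D\<close> into
  pairs of a remainder \<open>S\<close> and a quotient \<open>T\<close>. By periodicity the summand
  depends on \<open>S\<close> alone, so each \<open>S\<close> counts once per admissible
  \<open>T\<close>.\<close>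

lemma sum_reduced_residues_irreducible_mult:
  fixes P D :: "'a::{finite,field} poly" and f :: "'a poly \<Rightarrow> complex"
  assumes "irreducible P" "D \<noteq> 0" and periodic: "\<And>R. f (R mod D) = f R"
  shows "(\<Sum>R | R mod (P * D) = R \<and> coprime R (P * D). f R) =
    of_nat (CARD('a) ^ degree P - (if P dvd D then 0 else 1)) * (\<Sum>R | R mod D = R \<and> coprime R D. f R)"
proof -
  have "P \<noteq> 0" using assms(1) by auto
  let ?U = "{S. S mod D = S \<and> coprime S D}"
  let ?V = "\<lambda>S. {T. T mod P = T \<and> \<not> P dvd S + D * T}"
  have fin: "finite ?U" "finite (?V S)" for S
    using finite_residues[OF \<open>D \<noteq> 0\<close>] finite_residues[OF \<open>P \<noteq> 0\<close>] by (auto intro: finite_subset[rotated])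
  \<comment> \<open>Both sides say that a quotient is 0, and dividing by \<open>P * D\<close> is
    dividing by \<open>D\<close> and then by \<open>P\<close>.\<close>
  have res: "R mod (P * D) = R \<longleftrightarrow> (R div D) mod P = R div D" for R
    by (simp add: mod_eq_self_iff_div_eq_0 mult.commute[of P] poly_div_mult_right)
  have dm: "(S + D * T) mod D = S" "(S + D * T) div D = T" if "S mod D = S" for S T
  proof -
    show 1: "(S + D * T) mod D = S" using that by simp
    have "S div D = 0" using that by (simp add: mod_eq_self_iff_div_eq_0)
    then show "(S + D * T) div D = T" using \<open>D \<noteq> 0\<close> by simp
  qed
  have "(\<Sum>R | R mod (P * D) = R \<and> coprime R (P * D). f R) = (\<Sum>(S, T)\<in>Sigma ?U ?V. f S)"
  proof (rule sum.reindex_bij_witness[where i = "\<lambda>(S, T). S + D * T" and j = "\<lambda>R. (R mod D, R div D)"])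
    fix R assume "R \<in> {R. R mod (P * D) = R \<and> coprime R (P * D)}"
    then show "(R mod D, R div D) \<in> Sigma ?U ?V"
      using assms by (auto simp: res coprime_irreducible_mult_iff)
  next
    fix ST assume "ST \<in> Sigma ?U ?V"
    then obtain S T where ST: "ST = (S, T)" "S mod D = S" "coprime S D" "T mod P = T"
        "\<not> P dvd S + D * T" by auto
    have "coprime (S + D * T) D"
      using coprime_mod_left_iff[OF \<open>D \<noteq> 0\<close>, of "S + D * T"] ST dm(1) by simp
    then show "(case ST of (S, T) \<Rightarrow> S + D * T) \<in> {R. R mod (P * D) = R \<and> coprime R (P * D)}"
      using ST dm assms by (simp add: res coprime_irreducible_mult_iff)
  qed (use dm periodic in auto)
  also have "\<dots> = (\<Sum>S\<in>?U. \<Sum>T\<in>?V S. f S)"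
    by (rule sum.Sigma[symmetric]) (use fin in auto)
  also have "\<dots> = (\<Sum>S\<in>?U. of_nat (CARD('a) ^ degree P - (if P dvd D then 0 else 1)) * f S)"
    using assms by (intro sum.cong) (simp_all add: card_residues_not_dvd)
  finally show ?thesis by (simp only: sum_distrib_left)
qed

section \<open>The totient and its link to sums over reduced residues\<close>

lemma CARD_field_ge_2: "CARD('a::{finite,field}) \<ge> 2"
proof -
  have "card {0, 1 :: 'a} \<le> CARD('a)" by (intro card_mono) auto
  then show ?thesis by simp
qed

lemma pnorm_irreducible_gt_1:
  fixes P :: "'a::{finite,field} poly"
  assumes "irreducible P"
  shows "pnorm P > 1"
proof -
  have "P \<noteq> 0" using assms by auto
  then show ?thesis
    using irreducible_imp_degree_pos[OF assms] CARD_field_ge_2[where 'a = 'a]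
    by (simp add: pnorm_def one_less_power)
qed

lemma finite_monic_irreducible_divisors:
  fixes D :: "'a::{finite,field} poly"
  assumes "D \<noteq> 0"
  shows "finite {P. lead_coeff P = 1 \<and> irreducible P \<and> P dvd D}"
  using finite_poly_divisors[OF assms] by (rule finite_subset[rotated]) auto

lemma pphi_nonzero:
  fixes D :: "'a::{finite,field} poly"
  assumes "D \<noteq> 0"
  shows "pphi D \<noteq> 0"
proof -
  have "1 - inverse (pnorm P) \<noteq> 0" if "irreducible P" for P :: "'a poly"
    using pnorm_irreducible_gt_1[OF that] by (auto simp: field_simps)
  then show ?thesis
    using assms finite_monic_irreducible_divisors[OF assms] by (auto simp: pphi_def pnorm_def)
qed

text \<open>The multiplier is the same as for sums of periodic functions. If \<open>P\<close>
  divides \<open>D\<close>, only the norm changes; otherwise the product gains one factor, and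
  \<open>|P| * (1 - 1/|P|) = |P| - 1\<close>.\<close>

lemma pphi_irreducible_mult:
  fixes P D :: "'a::{finite,field} poly"
  assumes "lead_coeff P = 1" "irreducible P" "D \<noteq> 0"
  shows "pphi (P * D) = of_nat (CARD('a) ^ degree P - (if P dvd D then 0 else 1)) * pphi D"
proof -
  let ?A = "\<lambda>D. {P. lead_coeff P = 1 \<and> irreducible P \<and> P dvd D}"
  have "P \<noteq> 0" using assms by auto
  have A: "?A (P * D) = insert P (?A D)"
    using assms associated_monic_irreducible_eq[OF _ assms(1) _ assms(2)]
    by (auto simp: irreducible_dvd_mult_iff)
  have norm: "pnorm (P * D) = pnorm P * pnorm D"
    using assms \<open>P \<noteq> 0\<close> by (simp add: pnorm_def degree_mult_eq power_add)
  have P: "pnorm P = real (CARD('a) ^ degree P)" using \<open>P \<noteq> 0\<close> by (simp add: pnorm_def)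
  show ?thesis
  proof (cases "P dvd D")
    case True
    then have "?A (P * D) = ?A D" using A assms by auto
    then show ?thesis using True norm P by (simp add: pphi_def)
  next
    case False
    \<comment> \<open>The subtraction on the left is on naturals; it is exact because the power is
      at least 1.\<close>
    have "real (CARD('a) ^ degree P - 1) = pnorm P - 1"
      using P by (simp add: of_nat_diff)
    also have "\<dots> = pnorm P * (1 - inverse (pnorm P))"
      using pnorm_irreducible_gt_1[OF assms(2)] by (simp add: field_simps)
    finally show ?thesis
      using False norm finite_monic_irreducible_divisors[OF assms(3)] by (simp add: pphi_def A)
  qed
qed

text \<open>Each irreducible factor of \<open>K\<close> multiplies the sum and the totient by the
  same number. The cross-multiplied form avoids dividing by \<open>pphi D\<close>.\<close>

lemma sum_reduced_residues_mult:
  fixes K D :: "'a::{finite,field} poly" and f :: "'a poly \<Rightarrow> complex"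
  assumes "lead_coeff K = 1" "D \<noteq> 0" and periodic: "\<And>R. f (R mod D) = f R"
  shows "of_real (pphi D) * (\<Sum>R | R mod (K * D) = R \<and> coprime R (K * D). f R) =
    of_real (pphi (K * D)) * (\<Sum>R | R mod D = R \<and> coprime R D. f R)"
  using assms(1)
proof (induction K rule: monic_poly_induct)
  case (mult P K)
  have "K * D \<noteq> 0" using mult assms by auto
  \<comment> \<open>Periodicity is inherited by multiples of \<open>D\<close>, which lets the
    single-factor step apply to the modulus \<open>K * D\<close>.\<close>
  moreover have "f (R mod (K * D)) = f R" for R
    by (metis periodic mod_mod_cancel dvd_triv_right)
  ultimately show ?case
    using mult by (simp add: mult.assoc[of P K D] sum_reduced_residues_irreducible_mult
        pphi_irreducible_mult mult.left_commute[of "of_real (pphi D)"])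
qed simp

section \<open>Rescaling the modulus of a character\<close>

text \<open>The remainder of \<open>K * A\<close> modulo \<open>M * K\<close> is
  \<open>K * (A mod M)\<close>. As \<open>K\<close> is monic, its coefficient one below the degree
  of \<open>M * K\<close> is that of \<open>A mod M\<close> one below the degree of
  \<open>M\<close>.\<close>

lemma tcoeff_mult:
  fixes M K A :: "'a::{finite,field} poly"
  assumes "lead_coeff M = 1" "lead_coeff K = 1"
  shows "tcoeff (M * K) (K * A) = tcoeff M A"
proof -
  have nz: "M \<noteq> 0" "K \<noteq> 0" using assms by auto
  have mod: "(K * A) mod (M * K) = K * (A mod M)"
    by (metis mult.commute mult_mod_right)
  show ?thesis
  proof (cases "degree M = 0")
    \<comment> \<open>Here \<open>tcoeff M A\<close> is 0 by convention, while \<open>M * K\<close>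
      may have positive degree; its coefficient vanishes because the remainder is 0.\<close>
    case True
    then have "A mod M = 0"
      using nz by (simp add: mod_eq_0_iff_dvd is_unit_iff_degree unit_imp_dvd)
    then show ?thesis using True mod by (simp add: tcoeff_def)
  next
    case False
    then have "degree (A mod M) \<le> degree M - 1"
      using degree_mod_less[OF nz(1), of A] by auto
    then consider "degree (A mod M) = degree M - 1" | "degree (A mod M) < degree M - 1"
      by linarith
    then have "coeff (K * (A mod M)) (degree K + (degree M - 1)) =
        lead_coeff K * coeff (A mod M) (degree M - 1)"
    proof cases
      case 1
      then show ?thesis using coeff_mult_degree_sum[of K "A mod M"] by simp
    next
      case 2
      then have "degree (K * (A mod M)) < degree K + (degree M - 1)"
        using degree_mult_le[of K "A mod M"] by linarith
      then show ?thesis using 2 by (simp add: coeff_eq_0)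
    qed
    then show ?thesis
      using False nz assms mod by (simp add: tcoeff_def degree_mult_eq add.commute)
  qed
qed

text \<open>The right-hand side involves \<open>M\<close> and \<open>D\<close> only through their
  product, so exchanging the two divisors leaves the function of \<open>R\<close> unchanged.\<close>

lemma echar_div_eq:
  fixes H D M :: "'a::{finite,field} poly"
  assumes "lead_coeff M = 1" "lead_coeff D = 1" "D dvd H"
  shows "echar \<psi> (H div D) M R = \<psi> (tcoeff (M * D) (H * R))"
proof -
  have *: "D * (H div D * R) = H * R" by (metis assms(3) dvd_mult_div_cancel mult.assoc)
  show ?thesis
    using tcoeff_mult[OF assms(1,2), of "H div D * R"] unfolding * by (simp add: echar_def)
qed

lemma echar_mod: "echar \<psi> G D (R mod D) = echar \<psi> G D R"
  by (simp add: echar_def tcoeff_def mod_mult_right_eq)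

theorem theorem3p2:
  fixes \<psi> :: "'a::{finite,field} \<Rightarrow> complex" and H D\<^sub>1 D\<^sub>2 :: "'a poly"
  assumes "nontrivial_add_char \<psi>"
    and "lead_coeff D\<^sub>1 = 1" and "D\<^sub>1 dvd H"
    and "lead_coeff D\<^sub>2 = 1" and "D\<^sub>2 dvd H"
  shows "of_real (pphi D\<^sub>2) * eta \<psi> (H div D\<^sub>2) D\<^sub>1 = of_real (pphi D\<^sub>1) * eta \<psi> (H div D\<^sub>1) D\<^sub>2"
proof -
  define f where "f R = \<psi> (tcoeff (D\<^sub>1 * D\<^sub>2) (H * R))" for R
  have f1: "echar \<psi> (H div D\<^sub>2) D\<^sub>1 = f" and f2: "echar \<psi> (H div D\<^sub>1) D\<^sub>2 = f"
    using assms by (auto simp: f_def echar_div_eq mult.commute)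
  have nz: "D\<^sub>1 \<noteq> 0" "D\<^sub>2 \<noteq> 0" using assms by auto
  define N where "N = D\<^sub>1 * D\<^sub>2"
  define S where "S = (\<Sum>R | R mod N = R \<and> coprime R N. f R)"
  \<comment> \<open>Periodicity of \<open>f\<close> modulo \<open>D\<^sub>1\<close> is read off from
    its form \<open>f1\<close> as a character with that modulus; \<open>f2\<close> does the same for
    \<open>D\<^sub>2\<close>.\<close>
  have 1: "of_real (pphi D\<^sub>1) * S = of_real (pphi N) * eta \<psi> (H div D\<^sub>2) D\<^sub>1"
    using sum_reduced_residues_mult[OF assms(4) nz(1), of f] echar_mod[of \<psi> "H div D\<^sub>2" D\<^sub>1]
    by (simp add: f1 eta_def S_def N_def mult.commute[of D\<^sub>2])
  have 2: "of_real (pphi D\<^sub>2) * S = of_real (pphi N) * eta \<psi> (H div D\<^sub>1) D\<^sub>2"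
    using sum_reduced_residues_mult[OF assms(2) nz(2), of f] echar_mod[of \<psi> "H div D\<^sub>1" D\<^sub>2]
    by (simp add: f2 eta_def S_def N_def)
  \<comment> \<open>Both sides equal \<open>pphi D\<^sub>1 * pphi D\<^sub>2 * S\<close>; the factor
    \<open>pphi N\<close> is then cancelled.\<close>
  have "of_real (pphi N) * (of_real (pphi D\<^sub>2) * eta \<psi> (H div D\<^sub>2) D\<^sub>1) =
      of_real (pphi N) * (of_real (pphi D\<^sub>1) * eta \<psi> (H div D\<^sub>1) D\<^sub>2)"
    using 1 2 by (metis mult.left_commute)
  moreover have "pphi N \<noteq> 0" using nz by (simp add: N_def pphi_nonzero)
  ultimately show ?thesis by simp
qed

end
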